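(* In the house allocation model with ties, with $n=|N|$ agents and $m$ acceptable agent–object pairs: (1) If each agent's preference list is a single tie (the agent is indifferent among all its acceptable objects, and its list may be incomplete), then a majority stable matching exists and can be found in $O(\sqrt{n}\,m)$ time. (2) If each agent's preferences are dichotomous and complete and $|O|\ge |N|$, then a majority stable matching exists and can be found in $O(\sqrt{n}\,m)$ time. (3) If each agent's preferences are dichotomous and complete and $|O|<|N|$, then a $\left(\frac{2n}{3}+1\right)$-stable matching exists and can be found in $O(\sqrt{n}\,m)$ time.
   Context: House allocation model with ties: agents $N$ and objects $O$; each agent $i$ has a weak order (ties allowed) over a subset of $O$ (its acceptable objects); objects have no preferences. A matching is a set of agent–object pairs $(i,o)$ with $o$ acceptable to $i$ such that each agent and each object lies in at most one pair; $M(i)$ denotes the object of $i$ (possibly none). Agent $i$ prefers $M'$ to $M$, written $M'(i)\succ_i M(i)$, if $M'(i)$ is strictly better than $M(i)$ for $i$, where being matched to any acceptable object is strictly better than being unmatched. For a real number $k$, a matching $M$ is $k$-stable if there is no matching $M'$ with $|\{i\in N: M'(i)\succ_i M(i)\}|\ge k$; $M$ is majority stable if it is $\frac{n+1}{2}$-stable. Dichotomous and complete preferences: every object is acceptable to every agent, and each agent partitions $O$ into "good" and "bad" objects, strictly preferring every good object to every bad one and being indifferent within each class. *)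

theory Defs
  imports Complex_Main
begin

section \<open>House allocation with ties\<close>

text \<open>\<open>(x, y) \<in> Pref H i\<close> means that agent \<open>i\<close> finds \<open>x\<close> at least as good as \<open>y\<close>.\<close>

record ('a, 'b) house_model =
  Agents :: "'a set"
  Objects :: "'b set"
  Acc :: "'a \<Rightarrow> 'b set"
  Pref :: "'a \<Rightarrow> ('b \<times> 'b) set"

definition house_allocation :: "('a, 'b) house_model \<Rightarrow> bool" where
  "house_allocation H \<longleftrightarrow>
     finite (Agents H) \<and> finite (Objects H) \<and>
     (\<forall>i\<in>Agents H. Acc H i \<subseteq> Objects H \<and>
        preorder_on (Acc H i) (Pref H i) \<and> total_on (Acc H i) (Pref H i))"

definition strictly_better :: "('a, 'b) house_model \<Rightarrow> 'a \<Rightarrow> 'b \<Rightarrow> 'b \<Rightarrow> bool" where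
  "strictly_better H i x y \<longleftrightarrow> (x, y) \<in> Pref H i \<and> (y, x) \<notin> Pref H i"

definition indifferent :: "('a, 'b) house_model \<Rightarrow> 'a \<Rightarrow> 'b \<Rightarrow> 'b \<Rightarrow> bool" where
  "indifferent H i x y \<longleftrightarrow> (x, y) \<in> Pref H i \<and> (y, x) \<in> Pref H i"

definition acceptable_pairs :: "('a, 'b) house_model \<Rightarrow> ('a \<times> 'b) set" where
  "acceptable_pairs H = (SIGMA i:Agents H. Acc H i)"

definition matching :: "('a, 'b) house_model \<Rightarrow> ('a \<times> 'b) set \<Rightarrow> bool" where
  "matching H M \<longleftrightarrow> M \<subseteq> acceptable_pairs H \<and> single_valued M \<and> single_valued (M\<inverse>)"

definition assigned :: "('a \<times> 'b) set \<Rightarrow> 'a \<Rightarrow> 'b option" where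
  "assigned M i = (if \<exists>x. (i, x) \<in> M then Some (THE x. (i, x) \<in> M) else None)"

fun prefers :: "('a, 'b) house_model \<Rightarrow> 'a \<Rightarrow> 'b option \<Rightarrow> 'b option \<Rightarrow> bool" where
  "prefers H i (Some x) (Some y) \<longleftrightarrow> strictly_better H i x y"
| "prefers H i (Some x) None \<longleftrightarrow> x \<in> Acc H i"
| "prefers H i None z \<longleftrightarrow> False"

definition improving_agents ::
    "('a, 'b) house_model \<Rightarrow> ('a \<times> 'b) set \<Rightarrow> ('a \<times> 'b) set \<Rightarrow> 'a set" where
  "improving_agents H M M' = {i \<in> Agents H. prefers H i (assigned M' i) (assigned M i)}"

definition k_stable :: "real \<Rightarrow> ('a, 'b) house_model \<Rightarrow> ('a \<times> 'b) set \<Rightarrow> bool" where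
  "k_stable k H M \<longleftrightarrow> matching H M \<and>
     \<not> (\<exists>M'. matching H M' \<and> real (card (improving_agents H M M')) \<ge> k)"

definition majority_stable :: "('a, 'b) house_model \<Rightarrow> ('a \<times> 'b) set \<Rightarrow> bool" where
  "majority_stable H M \<longleftrightarrow> k_stable ((real (card (Agents H)) + 1) / 2) H M"

definition single_tie :: "('a, 'b) house_model \<Rightarrow> bool" where
  "single_tie H \<longleftrightarrow> (\<forall>i\<in>Agents H. \<forall>x\<in>Acc H i. \<forall>y\<in>Acc H i. indifferent H i x y)"

text \<open>Either of the classes \<open>Good\<close>, \<open>Bad\<close> of an agent may be empty.\<close>

definition dichotomous_complete :: "('a, 'b) house_model \<Rightarrow> bool" where
  "dichotomous_complete H \<longleftrightarrow>
     (\<forall>i\<in>Agents H. Acc H i = Objects H \<and>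
        (\<exists>Good Bad. Good \<union> Bad = Objects H \<and> Good \<inter> Bad = {} \<and>
           (\<forall>x\<in>Good. \<forall>y\<in>Bad. strictly_better H i x y) \<and>
           (\<forall>x\<in>Good. \<forall>y\<in>Good. indifferent H i x y) \<and>
           (\<forall>x\<in>Bad. \<forall>y\<in>Bad. indifferent H i x y)))"


section \<open>Machine model\<close>

text \<open>
  A structured form of the uniform-cost random access machine over the natural numbers, with
  addition and truncated subtraction as the only arithmetic. The memory consists of unbounded
  arrays, named by numbers; array names in a program are constants, so a program uses only finitely
  many arrays (a machine with a single memory simulates them by interleaving, with constant
  overhead). A program variable is an array that is only used at index 0.
\<close>

type_synonym mem = "nat \<Rightarrow> nat \<Rightarrow> nat"

datatype expr =
    Const nat
  | Load nat expr
  | Plus expr expr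
  | Minus expr expr

fun eval_expr :: "expr \<Rightarrow> mem \<Rightarrow> nat" where
  "eval_expr (Const c) s = c"
| "eval_expr (Load a e) s = s a (eval_expr e s)"
| "eval_expr (Plus e f) s = eval_expr e s + eval_expr f s"
| "eval_expr (Minus e f) s = eval_expr e s - eval_expr f s"

fun expr_cost :: "expr \<Rightarrow> nat" where
  "expr_cost (Const c) = 1"
| "expr_cost (Load a e) = 1 + expr_cost e"
| "expr_cost (Plus e f) = 1 + expr_cost e + expr_cost f"
| "expr_cost (Minus e f) = 1 + expr_cost e + expr_cost f"

text \<open>\<open>Store a e f\<close> writes the value of \<open>f\<close> to index \<open>e\<close> of array \<open>a\<close>; a test succeeds iff its value
  is nonzero.\<close>

datatype prog =
    Skip
  | Store nat expr expr
  | Seq prog prog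
  | Cond expr prog prog
  | While expr prog

text \<open>\<open>run p s t s'\<close>: started in \<open>s\<close>, program \<open>p\<close> halts in \<open>s'\<close> after exactly \<open>t\<close> steps.\<close>

inductive run :: "prog \<Rightarrow> mem \<Rightarrow> nat \<Rightarrow> mem \<Rightarrow> bool" where
  run_Skip: "run Skip s 1 s"
| run_Store: "run (Store a e f) s (1 + expr_cost e + expr_cost f)
     (s(a := (s a)(eval_expr e s := eval_expr f s)))"
| run_Seq: "run p s t s' \<Longrightarrow> run q s' u s'' \<Longrightarrow> run (Seq p q) s (t + u) s''"
| run_Cond_True: "eval_expr e s \<noteq> 0 \<Longrightarrow> run p s t s' \<Longrightarrow> run (Cond e p q) s (1 + expr_cost e + t) s'"
| run_Cond_False: "eval_expr e s = 0 \<Longrightarrow> run q s t s' \<Longrightarrow> run (Cond e p q) s (1 + expr_cost e + t) s'"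
| run_While_False: "eval_expr e s = 0 \<Longrightarrow> run (While e p) s (1 + expr_cost e) s"
| run_While_True: "eval_expr e s \<noteq> 0 \<Longrightarrow> run p s t s' \<Longrightarrow> run (While e p) s' u s'' \<Longrightarrow>
     run (While e p) s (1 + expr_cost e + t + u) s''"

inductive_cases run_SkipE: "run Skip s t s'"
inductive_cases run_StoreE: "run (Store a e f) s t s'"
inductive_cases run_SeqE: "run (Seq p q) s t s'"
inductive_cases run_CondE: "run (Cond e p q) s t s'"
inductive_cases run_WhileE: "run (While e p) s t s'"

lemma run_deterministic: "run p s t s' \<Longrightarrow> run p s u s'' \<Longrightarrow> u = t \<and> s'' = s'"
proof (induction arbitrary: u s'' rule: run.induct)
  case (run_Skip s)
  then show ?case by (rule run_SkipE) simp
next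
  case (run_Store a e f s)
  then show ?case by (rule run_StoreE) simp
next
  case (run_Seq p s t s' q v w)
  from run_Seq.prems obtain t1 s1 t2 where
    *: "u = t1 + t2" "run p s t1 s1" "run q s1 t2 s''" by (rule run_SeqE)
  note IH1 = run_Seq.IH(1)[OF *(2)]
  note IH2 = run_Seq.IH(2)[OF *(3)[unfolded IH1[THEN conjunct2]]]
  show ?case by (simp add: *(1) IH1 IH2)
next
  case (run_Cond_True e s p t s' q)
  from run_Cond_True.prems run_Cond_True.hyps(1)
  obtain t1 where *: "u = 1 + expr_cost e + t1" "run p s t1 s''" by (auto elim: run_CondE)
  show ?case by (simp add: *(1) run_Cond_True.IH[OF *(2)])
next
  case (run_Cond_False e s q t s' p)
  from run_Cond_False.prems run_Cond_False.hyps(1)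
  obtain t1 where *: "u = 1 + expr_cost e + t1" "run q s t1 s''" by (auto elim: run_CondE)
  show ?case by (simp add: *(1) run_Cond_False.IH[OF *(2)])
next
  case (run_While_False e s p)
  from run_While_False.prems run_While_False.hyps show ?case by (auto elim: run_WhileE)
next
  case (run_While_True e s p t s' v w)
  from run_While_True.prems run_While_True.hyps(1) obtain t1 s1 t2 where
    *: "u = 1 + expr_cost e + t1 + t2" "run p s t1 s1" "run (While e p) s1 t2 s''"
    by (auto elim: run_WhileE)
  note IH1 = run_While_True.IH(1)[OF *(2)]
  note IH2 = run_While_True.IH(2)[OF *(3)[unfolded IH1[THEN conjunct2]]]
  show ?case by (simp add: *(1) IH1 IH2)
qed


section \<open>Input, output and running time\<close>

text \<open>\<open>tie_index H i x\<close> is the position, counted from 0, of the tie containing \<open>x\<close> in the preference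
  list of \<open>i\<close>, i.e. the number of indifference classes that are strictly better than \<open>x\<close>.\<close>

definition tie_index :: "('a, 'b) house_model \<Rightarrow> 'a \<Rightarrow> 'b \<Rightarrow> nat" where
  "tie_index H i x =
     card ((\<lambda>y. {z. indifferent H i y z}) ` {y. strictly_better H i y x})"

text \<open>The input of a machine is the list of all acceptable pairs, in arbitrary order, each with its
  tie index. Agents and objects are numbered consecutively from 0.\<close>

definition numbered :: "(nat, nat) house_model \<Rightarrow> bool" where
  "numbered H \<longleftrightarrow> Agents H = {..<card (Agents H)} \<and> Objects H = {..<card (Objects H)}"

definition lists_pairs :: "(nat \<times> nat) list \<Rightarrow> (nat, nat) house_model \<Rightarrow> bool" where
  "lists_pairs es H \<longleftrightarrow> distinct es \<and> set es = acceptable_pairs H"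

text \<open>Array 0 holds the numbers of agents, objects and acceptable pairs; arrays 1, 2, 3 hold the
  agents, objects and tie indices of the listed pairs. All other memory is 0.\<close>

definition input_mem :: "(nat, nat) house_model \<Rightarrow> (nat \<times> nat) list \<Rightarrow> mem" where
  "input_mem H es = (\<lambda>a j.
     if a = 0 then
       (if j = 0 then card (Agents H) else if j = 1 then card (Objects H)
        else if j = 2 then length es else 0)
     else if j < length es then
       (if a = 1 then fst (es ! j) else if a = 2 then snd (es ! j)
        else if a = 3 then tie_index H (fst (es ! j)) (snd (es ! j)) else 0)
     else 0)"

text \<open>The output is read off as a list of pairs: its length from index 0 of array 4, its agents and
  objects from arrays 5 and 6.\<close>

definition output_matching :: "mem \<Rightarrow> (nat \<times> nat) set" where
  "output_matching s = {(s 5 j, s 6 j) | j. j < s 4 0}"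

text \<open>A solution can be found in \<open>O(T)\<close> time on the class \<open>\<C>\<close> of instances if a single program
  does so, with a single constant, on all of them. The maximum with 1 only matters for instances
  with \<open>T H < 1\<close>, such as those without acceptable pairs when \<open>T\<close> is proportional to their number:
  there the program still has to halt in constant time.\<close>

definition found_in_time ::
    "((nat, nat) house_model \<Rightarrow> bool) \<Rightarrow> ((nat, nat) house_model \<Rightarrow> (nat \<times> nat) set \<Rightarrow> bool) \<Rightarrow>
     ((nat, nat) house_model \<Rightarrow> real) \<Rightarrow> bool" where
  "found_in_time \<C> Sol T \<longleftrightarrow>
     (\<exists>p. \<exists>C::real. \<forall>H es. house_allocation H \<and> numbered H \<and> \<C> H \<and> lists_pairs es H \<longrightarrow>
        (\<exists>t s'. run p (input_mem H es) t s' \<and> real t \<le> C * max 1 (T H) \<and>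
           Sol H (output_matching s')))"

definition sqrt_n_m :: "('a, 'b) house_model \<Rightarrow> real" where
  "sqrt_n_m H = sqrt (real (card (Agents H))) * real (card (acceptable_pairs H))"

end

theory Submission
  imports Defs
begin

text \<open>
  A matching of maximum size is not needed: a greedy matching suffices, and greedy matchings can be
  found in linear time. Scan the list of pairs once, greedily matching pairs \<open>(i, x)\<close> in which \<open>x\<close>
  is a top object of \<open>i\<close>, and let \<open>G\<close> be the result; scan the list again, greedily extending \<open>G\<close>
  to \<open>M\<close> by arbitrary pairs. If \<open>M'\<close> is another matching, then every agent who improves to a top
  object is improved by an object that \<open>G\<close> uses already, and is not matched by \<open>G\<close>.

  For single ties \<open>M = G\<close>, so at most \<open>min |M| (n - |M|) \<le> n / 2\<close> agents improve. For dichotomous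
  preferences, at most \<open>min |G| (|M| - |G|) \<le> |M| / 2\<close> agents improve from a bad to a good object,
  and at most \<open>n - |M|\<close> agents improve from being unmatched. If \<open>|O| \<ge> n\<close>, then \<open>|M| = n\<close>. If
  \<open>|O| < n\<close>, then \<open>|M| = |O|\<close>, so the number of improving agents is at most \<open>n - |O| / 2\<close>, and also
  at most \<open>|O|\<close>; the smaller one of these bounds is at most \<open>2 n / 3\<close>.
\<close>

subsection \<open>Stability of greedy matchings\<close>

text \<open>Tie index 0 stands for maximality in \<open>Pref\<close> because it is what a program
  can read from its input.\<close>

definition top_pairs :: "('a, 'b) house_model \<Rightarrow> ('a \<times> 'b) set" where
  "top_pairs H = {(i, x) \<in> acceptable_pairs H. tie_index H i x = 0}"

text \<open>For a matching \<open>M\<close> inside \<open>E\<close> this is inclusion-maximality: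
  every pair of \<open>E\<close> shares an agent or an object with \<open>M\<close>.\<close>

definition covers :: "('a \<times> 'b) set \<Rightarrow> ('a \<times> 'b) set \<Rightarrow> bool" where
  "covers M E \<longleftrightarrow> (\<forall>(i, x)\<in>E. i \<in> Domain M \<or> x \<in> Range M)"

text \<open>The interface between the combinatorial and the algorithmic half: stability is derived
  from this property, and the program is shown to establish it.\<close>

definition two_phase_greedy :: "('a, 'b) house_model \<Rightarrow> ('a \<times> 'b) set \<Rightarrow> bool" where
  "two_phase_greedy H M \<longleftrightarrow> matching H M \<and> covers M (acceptable_pairs H) \<and>
     (\<exists>G. G \<subseteq> M \<and> G \<subseteq> top_pairs H \<and> covers G (top_pairs H))"

section \<open>Finiteness, tie indices and sizes of matchings\<close>

lemma finite_acceptable_pairs: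
  assumes "house_allocation H"
  shows "finite (acceptable_pairs H)"
  unfolding acceptable_pairs_def
proof (rule finite_SigmaI)
  show "finite (Agents H)" using assms by (simp add: house_allocation_def)
  show "finite (Acc H i)" if "i \<in> Agents H" for i
    using assms that by (meson finite_subset house_allocation_def)
qed

lemma strictly_better_acceptable:
  assumes "house_allocation H" "i \<in> Agents H" "strictly_better H i x y"
  shows "x \<in> Acc H i" "y \<in> Acc H i"
  using assms by (auto simp: house_allocation_def strictly_better_def preorder_on_def)

text \<open>Finiteness of the set of better objects has to be shown first, since \<open>card\<close>
  is 0 on infinite sets too.\<close>

lemma tie_index_eq_0_iff:
  assumes "house_allocation H" "i \<in> Agents H"
  shows "tie_index H i x = 0 \<longleftrightarrow> (\<forall>y. \<not> strictly_better H i y x)"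
proof -
  have "{y. strictly_better H i y x} \<subseteq> Objects H"
    using strictly_better_acceptable[OF assms] assms by (fastforce simp: house_allocation_def)
  then have "finite {y. strictly_better H i y x}"
    using assms(1) by (meson finite_subset house_allocation_def)
  then show ?thesis by (auto simp: tie_index_def)
qed

lemma matching_finite: "house_allocation H \<Longrightarrow> matching H M \<Longrightarrow> finite M"
  using finite_acceptable_pairs finite_subset by (auto simp: matching_def)

lemma matching_Domain: "matching H M \<Longrightarrow> Domain M \<subseteq> Agents H"
  by (auto simp: matching_def acceptable_pairs_def)

lemma matching_Range: "house_allocation H \<Longrightarrow> matching H M \<Longrightarrow> Range M \<subseteq> Objects H"
  by (auto simp: matching_def acceptable_pairs_def house_allocation_def)

lemma card_Domain_eq:
  assumes "single_valued M"
  shows "card (Domain M) = card M"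
proof -
  have "inj_on fst M" using assms by (auto simp: inj_on_def single_valued_def)
  then show ?thesis by (simp add: Domain_fst card_image)
qed

lemma card_Range_eq:
  assumes "single_valued (M\<inverse>)"
  shows "card (Range M) = card M"
proof -
  have "inj_on snd M" using assms by (auto simp: inj_on_def single_valued_def)
  then show ?thesis by (simp add: Range_snd card_image)
qed

text \<open>Choosing a partner in \<open>R\<close> for each agent is injective, as no object is
  matched twice. It is applied with \<open>R\<close> the objects used by \<open>M\<close> or
  \<open>G\<close>, or all objects.\<close>

lemma card_le_if_matched_into:
  assumes "single_valued (M\<inverse>)" "finite R" "\<And>i. i \<in> A \<Longrightarrow> \<exists>x\<in>R. (i, x) \<in> M"
  shows "card A \<le> card R"
proof -
  obtain f where f: "\<And>i. i \<in> A \<Longrightarrow> f i \<in> R \<and> (i, f i) \<in> M"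
    using assms(3) by metis
  have "inj_on f A"
    by (rule inj_onI) (metis assms(1) converseI f single_valuedD)
  then show ?thesis
    using f assms(2) by (intro card_inj_on_le[of f]) auto
qed

lemma assigned_eq_Some:
  assumes "single_valued M"
  shows "assigned M i = Some x \<longleftrightarrow> (i, x) \<in> M"
proof
  assume "assigned M i = Some x"
  then have "\<exists>x. (i, x) \<in> M" "x = (THE x. (i, x) \<in> M)"
    by (auto simp: assigned_def split: if_splits)
  then show "(i, x) \<in> M"
    using assms by (metis single_valuedD the_equality)
next
  assume "(i, x) \<in> M"
  then show "assigned M i = Some x"
    using assms by (auto simp: assigned_def single_valued_def)
qed

lemma assigned_eq_None: "assigned M i = None \<longleftrightarrow> i \<notin> Domain M"
  by (auto simp: assigned_def)

text \<open>Agents who were unmatched and agents who trade one object for another are bounded by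
  different arguments.\<close>

lemma improving_agentE:
  assumes "matching H M" "matching H M'" "i \<in> improving_agents H M M'"
  obtains x where "i \<in> Agents H" "(i, x) \<in> M'" "i \<notin> Domain M"
  | x y where "i \<in> Agents H" "(i, x) \<in> M'" "(i, y) \<in> M" "strictly_better H i x y"
proof -
  have sv: "single_valued M" "single_valued M'" using assms by (auto simp: matching_def)
  have i: "i \<in> Agents H" "prefers H i (assigned M' i) (assigned M i)"
    using assms(3) by (auto simp: improving_agents_def)
  then obtain x where x: "assigned M' i = Some x"
    by (cases "assigned M' i") auto
  show thesis
  proof (cases "assigned M i")
    case None
    then show thesis using that(1) i x sv by (simp add: assigned_eq_Some assigned_eq_None)
  next
    case (Some y)
    then have "(i, x) \<in> M'" "(i, y) \<in> M" "strictly_better H i x y"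
      using i(2) x Some by (auto simp: assigned_eq_Some[OF sv(1)] assigned_eq_Some[OF sv(2)])
    then show thesis using that(2) i(1) by blast
  qed
qed

lemma k_stableI:
  assumes "matching H M"
    and "\<And>M'. matching H M' \<Longrightarrow> real (card (improving_agents H M M')) < k"
  shows "k_stable k H M"
  using assms by (force simp: k_stable_def)

text \<open>Indifference leaves only unmatched agents to improve, and maximality of \<open>M\<close>
  forces their new objects into \<open>Range M\<close>. Adding the bounds |M| and n - |M| gives 2
  |I| \<le> n.\<close>

lemma single_tie_majority_stable:
  assumes H: "house_allocation H" and tie: "single_tie H" and M: "two_phase_greedy H M"
  shows "majority_stable H M"
  unfolding majority_stable_def
proof (rule k_stableI)
  show m: "matching H M" using M by (simp add: two_phase_greedy_def)
  have cov: "covers M (acceptable_pairs H)" using M by (simp add: two_phase_greedy_def)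
  have fin: "finite (Agents H)" "finite M"
    using H matching_finite[OF H m] by (auto simp: house_allocation_def)
  fix M' assume m': "matching H M'"
  let ?I = "improving_agents H M M'"
  have I: "i \<in> Agents H \<and> i \<notin> Domain M \<and> (\<exists>x\<in>Range M. (i, x) \<in> M')" if "i \<in> ?I" for i
    using m m' that
  proof (cases rule: improving_agentE)
    case (1 x)
    moreover have "(i, x) \<in> acceptable_pairs H" using 1 m' by (auto simp: matching_def)
    ultimately show ?thesis using cov by (auto simp: covers_def)
  next
    case (2 x y)
    then have "x \<in> Acc H i" "y \<in> Acc H i" using strictly_better_acceptable[OF H] by blast+
    then have "indifferent H i x y" using tie 2 by (auto simp: single_tie_def)
    then show ?thesis using 2 by (auto simp: indifferent_def strictly_better_def)
  qed
  have "card ?I \<le> card (Range M)"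
    using m' fin I by (intro card_le_if_matched_into[of M']) (auto simp: matching_def finite_Range)
  moreover have "card (Range M) = card (Domain M)"
    using m by (simp add: card_Range_eq card_Domain_eq matching_def)
  moreover have "card ?I + card (Domain M) \<le> card (Agents H)"
  proof -
    have "card (?I \<union> Domain M) = card ?I + card (Domain M)"
      using I fin by (intro card_Un_disjoint) (auto intro: finite_subset finite_Domain)
    moreover have "card (?I \<union> Domain M) \<le> card (Agents H)"
      using I matching_Domain[OF m] fin by (intro card_mono) auto
    ultimately show ?thesis by simp
  qed
  ultimately show "real (card ?I) < (real (card (Agents H)) + 1) / 2" by simp
qed

text \<open>A strict improvement goes from bad to good. If one class is empty, tie index 0 does not
  separate the classes, but then there is no strict improvement.\<close>

lemma dichotomous_improvement:
  assumes H: "house_allocation H" "dichotomous_complete H"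
    and i: "i \<in> Agents H" "strictly_better H i x y"
  shows "tie_index H i x = 0" "tie_index H i y \<noteq> 0"
proof -
  obtain Good Bad where GB: "Good \<union> Bad = Objects H" and acc: "Acc H i = Objects H"
      "\<forall>x\<in>Good. \<forall>y\<in>Bad. strictly_better H i x y"
      "\<forall>x\<in>Good. \<forall>y\<in>Good. indifferent H i x y" "\<forall>x\<in>Bad. \<forall>y\<in>Bad. indifferent H i x y"
    using H(2) i(1) unfolding dichotomous_complete_def by metis
  have cases: "u \<in> Good \<and> v \<in> Bad" if "strictly_better H i u v" for u v
  proof -
    have "u \<in> Good \<union> Bad" "v \<in> Good \<union> Bad"
      using strictly_better_acceptable[OF H(1) i(1) that] acc GB by auto
    then show ?thesis
      using acc that unfolding strictly_better_def indifferent_def by blast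
  qed
  \<comment> \<open>Such a \<open>z\<close> would make \<open>x\<close> bad, but \<open>x\<close> is
    good.\<close>
  have "\<not> strictly_better H i z x" for z
    using cases[OF i(2)] cases[of z x] acc unfolding strictly_better_def indifferent_def by blast
  then show "tie_index H i x = 0" by (simp add: tie_index_eq_0_iff[OF H(1) i(1)])
  show "tie_index H i y \<noteq> 0" using i by (auto simp: tie_index_eq_0_iff[OF H(1) i(1)])
qed

text \<open>Here \<open>?A\<close> are the improving agents matched by \<open>M\<close> and
  \<open>?B\<close> the others. The bounds 2 |A| \<le> |M| and |B| \<le> n - |M| combine to the
  claim, stated additively to avoid subtraction on naturals.\<close>

lemma dichotomous_card_improving:
  assumes H: "house_allocation H" and dich: "dichotomous_complete H"
    and M: "two_phase_greedy H M" and m': "matching H M'"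
  shows "2 * card (improving_agents H M M') + card M \<le> 2 * card (Agents H)"
proof -
  let ?I = "improving_agents H M M'" and ?D = "Domain M"
  let ?A = "?I \<inter> ?D" and ?B = "?I - ?D"
  have m: "matching H M" using M by (simp add: two_phase_greedy_def)
  have fin: "finite (Agents H)" "finite M" "finite ?D"
    using H matching_finite[OF H m] by (auto simp: house_allocation_def finite_Domain)
  obtain G where G: "G \<subseteq> M" "G \<subseteq> top_pairs H" "covers G (top_pairs H)"
    using M by (auto simp: two_phase_greedy_def)
  have finG: "finite G" using G(1) fin(2) finite_subset by blast
  have sv: "single_valued M" "single_valued (M\<inverse>)" "single_valued (M'\<inverse>)"
    using m m' by (auto simp: matching_def)
  have svG: "single_valued G" "single_valued (G\<inverse>)"
    using sv G(1) by (meson single_valued_subset converse_mono)+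
  have A: "i \<notin> Domain G \<and> (\<exists>x\<in>Range G. (i, x) \<in> M')" if "i \<in> ?A" for i
  proof -
    from that have i: "i \<in> ?I" "i \<in> ?D" by auto
    from m m' i(1) show ?thesis
    proof (cases rule: improving_agentE)
      case (1 x)
      then show ?thesis using i by auto
    next
      case (2 x y)
      note t = dichotomous_improvement[OF H dich 2(1,4)]
      have top: "(i, x) \<in> top_pairs H"
        using 2 m' t by (auto simp: top_pairs_def matching_def)
      \<comment> \<open>As \<open>G\<close> is part of \<open>M\<close>, it could only give
        \<open>y\<close> to \<open>i\<close>, but \<open>y\<close> is not a top object of
        \<open>i\<close>.\<close>
      have notG: "i \<notin> Domain G"
      proof
        assume "i \<in> Domain G"
        then obtain z where "(i, z) \<in> G" by auto
        moreover from this have "z = y" using G(1) 2(3) sv(1) by (auto simp: single_valued_def)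
        ultimately show False using G(2) t by (auto simp: top_pairs_def)
      qed
      then have "x \<in> Range G" using G(3) top by (auto simp: covers_def)
      then show ?thesis using notG 2 by auto
    qed
  qed
  have "card ?A \<le> card (Range G)"
    using sv A finG by (intro card_le_if_matched_into[of M']) (auto simp: finite_Range)
  then have 1: "card ?A \<le> card (Domain G)"
    using svG by (simp add: card_Range_eq card_Domain_eq)
  \<comment> \<open>The second bound, |A| \<le> |M| - |G|: \<open>?A\<close> lies in
    \<open>Domain M\<close> and avoids \<open>Domain G\<close>.\<close>
  have "card ?A + card (Domain G) = card (?A \<union> Domain G)"
    using A fin finG by (subst card_Un_disjoint) (auto simp: finite_Domain)
  also have "\<dots> \<le> card ?D"
    using G(1) fin by (intro card_mono) auto
  finally have 2: "2 * card ?A \<le> card ?D" using 1 by simp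
  have "?I \<subseteq> Agents H" by (auto simp: improving_agents_def)
  then have "finite ?I" using fin(1) by (rule finite_subset)
  then have "card ?I = card ?A + card ?B" "finite ?B"
    by (simp_all add: card_Int_Diff)
  moreover have "card ?B + card ?D = card (?B \<union> ?D)"
    using fin \<open>finite ?B\<close> by (subst card_Un_disjoint) auto
  moreover have "card (?B \<union> ?D) \<le> card (Agents H)"
    using \<open>?I \<subseteq> Agents H\<close> matching_Domain[OF m] fin by (intro card_mono) auto
  ultimately show ?thesis using 2 card_Domain_eq[OF sv(1)] by linarith
qed

text \<open>With complete lists, a free agent and a free object would form an uncovered pair, so one
  side is exhausted.\<close>

lemma card_covering_matching_complete:
  assumes H: "house_allocation H" and dich: "dichotomous_complete H"
    and m: "matching H M" and cov: "covers M (acceptable_pairs H)"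
  shows "card M = min (card (Agents H)) (card (Objects H))"
proof -
  have fin: "finite (Agents H)" "finite (Objects H)" using H by (auto simp: house_allocation_def)
  have eq: "card (Domain M) = card M" "card (Range M) = card M"
    using m by (auto simp: matching_def card_Domain_eq card_Range_eq)
  note sub = matching_Domain[OF m] matching_Range[OF H m]
  have "Domain M = Agents H \<or> Range M = Objects H"
  proof (rule ccontr)
    assume "\<not> ?thesis"
    then obtain i x where "i \<in> Agents H" "i \<notin> Domain M" "x \<in> Objects H" "x \<notin> Range M"
      using sub by blast
    then show False
      using cov dich by (force simp: covers_def acceptable_pairs_def dichotomous_complete_def)
  qed
  moreover have "card (Domain M) \<le> card (Agents H)" "card (Range M) \<le> card (Objects H)"
    using sub fin by (auto intro: card_mono)
  ultimately show ?thesis using eq by auto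
qed

lemma dichotomous_majority_stable:
  assumes H: "house_allocation H" "dichotomous_complete H"
    and le: "card (Agents H) \<le> card (Objects H)" and M: "two_phase_greedy H M"
  shows "majority_stable H M"
  unfolding majority_stable_def
proof (rule k_stableI)
  show m: "matching H M" using M by (simp add: two_phase_greedy_def)
  fix M' assume "matching H M'"
  note dichotomous_card_improving[OF H M this]
  moreover have "card M = card (Agents H)"
    using card_covering_matching_complete[OF H m] M le by (simp add: two_phase_greedy_def)
  ultimately have "2 * card (improving_agents H M M') \<le> card (Agents H)" by simp
  then show "real (card (improving_agents H M M')) < (real (card (Agents H)) + 1) / 2"
    by simp
qed

text \<open>Adding |I| \<le> |O| and 2 |I| + |O| \<le> 2 n eliminates |O| and leaves 3 |I| \<le> 2
  n.\<close>

lemma dichotomous_two_thirds_stable: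
  assumes H: "house_allocation H" "dichotomous_complete H"
    and less: "card (Objects H) < card (Agents H)" and M: "two_phase_greedy H M"
  shows "k_stable (2 * real (card (Agents H)) / 3 + 1) H M"
proof (rule k_stableI)
  show m: "matching H M" using M by (simp add: two_phase_greedy_def)
  fix M' assume m': "matching H M'"
  have "card (improving_agents H M M') \<le> card (Objects H)"
  proof (rule card_le_if_matched_into)
    show "single_valued (M'\<inverse>)" using m' by (simp add: matching_def)
    show "finite (Objects H)" using H by (simp add: house_allocation_def)
    fix i assume "i \<in> improving_agents H M M'"
    with m m' have "i \<in> Domain M'" by (cases rule: improving_agentE) auto
    then show "\<exists>x\<in>Objects H. (i, x) \<in> M'" using matching_Range[OF H(1) m'] by auto
  qed
  moreover note dichotomous_card_improving[OF H M m']
  moreover have "card M = card (Objects H)"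
    using card_covering_matching_complete[OF H m] M less by (simp add: two_phase_greedy_def)
  ultimately show "real (card (improving_agents H M M')) < 2 * real (card (Agents H)) / 3 + 1"
    by linarith
qed


subsection \<open>The greedy algorithm\<close>

definition greedy_step :: "'a \<times> 'b \<Rightarrow> ('a \<times> 'b) set \<Rightarrow> ('a \<times> 'b) set" where
  "greedy_step e M = (if fst e \<in> Domain M \<or> snd e \<in> Range M then M else insert e M)"

section \<open>Invariants of a greedy scan from an arbitrary start\<close>

lemma greedy_single_valued:
  assumes "single_valued M" "single_valued (M\<inverse>)"
  shows "single_valued (fold greedy_step es M)" "single_valued ((fold greedy_step es M)\<inverse>)"
proof -
  have "single_valued (fold greedy_step es M) \<and> single_valued ((fold greedy_step es M)\<inverse>)"
    using assms
  proof (induction es arbitrary: M)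
    case (Cons e es)
    have "single_valued (greedy_step e M)" "single_valued ((greedy_step e M)\<inverse>)"
      using Cons.prems by (cases e, auto simp: greedy_step_def single_valued_def)+
    then show ?case using Cons.IH by simp
  qed simp
  then show "single_valued (fold greedy_step es M)" "single_valued ((fold greedy_step es M)\<inverse>)"
    by auto
qed

lemma greedy_increasing: "M \<subseteq> fold greedy_step es M"
proof (induction es arbitrary: M)
  case (Cons e es)
  have "M \<subseteq> greedy_step e M" by (auto simp: greedy_step_def)
  also have "\<dots> \<subseteq> fold greedy_step es (greedy_step e M)" by (rule Cons.IH)
  finally show ?case by simp
qed simp

lemma greedy_subset: "fold greedy_step es M \<subseteq> M \<union> set es"
proof (induction es arbitrary: M)
  case (Cons e es)
  have "greedy_step e M \<subseteq> insert e M" by (auto simp: greedy_step_def)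
  then show ?case using Cons.IH[of "greedy_step e M"] by auto
qed simp

text \<open>A pair is covered right after its own step and remains so because later steps only add
  pairs.\<close>

lemma greedy_covers: "covers (fold greedy_step es M) (set es)"
proof (induction es arbitrary: M)
  case (Cons e es)
  obtain i x where e: "e = (i, x)" by force
  have "i \<in> Domain (greedy_step e M) \<or> x \<in> Range (greedy_step e M)"
    by (auto simp: greedy_step_def e)
  then have "i \<in> Domain (fold greedy_step (e # es) M) \<or> x \<in> Range (fold greedy_step (e # es) M)"
    using greedy_increasing[of "greedy_step e M" es] by auto
  then show ?case using Cons.IH[of "greedy_step e M"] by (auto simp: covers_def e)
qed (simp add: covers_def)

text \<open>The parameter \<open>r\<close> abstracts from tie indices, so that the program can be
  analysed from the contents of its arrays alone.\<close>

definition two_phase :: "('a \<times> 'b \<Rightarrow> nat) \<Rightarrow> ('a \<times> 'b) list \<Rightarrow> ('a \<times> 'b) set" where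
  "two_phase r es =
     fold greedy_step es (fold greedy_step (filter (\<lambda>e. r e = 0) es) {})"

lemma two_phase_greedy_two_phase:
  assumes "set es = acceptable_pairs H"
  shows "two_phase_greedy H (two_phase (\<lambda>(i, x). tie_index H i x) es)"
proof -
  let ?r = "\<lambda>(i, x). tie_index H i x"
  let ?es = "filter (\<lambda>e. ?r e = 0) es"
  let ?G = "fold greedy_step ?es {}" and ?M = "two_phase ?r es"
  have top: "set ?es = top_pairs H" using assms by (auto simp: top_pairs_def)
  have "?G \<subseteq> top_pairs H" using greedy_subset[of ?es "{}"] top by simp
  moreover have "covers ?G (top_pairs H)" using greedy_covers[of ?es "{}"] top by simp
  moreover have GM: "?G \<subseteq> ?M" unfolding two_phase_def by (rule greedy_increasing)
  moreover have "covers ?M (acceptable_pairs H)"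
    unfolding two_phase_def assms[symmetric] by (rule greedy_covers)
  moreover have "?M \<subseteq> acceptable_pairs H"
    using greedy_subset[of es ?G] \<open>?G \<subseteq> top_pairs H\<close> assms
    by (auto simp: two_phase_def top_pairs_def)
  moreover have "single_valued ?M" "single_valued (?M\<inverse>)"
    unfolding two_phase_def by (intro greedy_single_valued; simp)+
  ultimately show ?thesis by (auto simp: two_phase_greedy_def matching_def)
qed

lemma two_phase_greedy_exists:
  assumes "house_allocation H"
  shows "\<exists>M. two_phase_greedy H M"
  using finite_list[OF finite_acceptable_pairs[OF assms]] two_phase_greedy_two_phase by blast


subsection \<open>The machine program\<close>

text \<open>Array 7 is the position in the list of pairs; arrays 8 and 9 flag the matched agents and
  objects.\<close>

definition agent_expr :: expr where "agent_expr = Load 1 (Load 7 (Const 0))"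
definition object_expr :: expr where "object_expr = Load 2 (Load 7 (Const 0))"
definition count_expr :: expr where "count_expr = Load 4 (Const 0)"

text \<open>The counter is incremented last, since it addresses the writes to arrays 5 and
  6.\<close>

definition add_prog :: prog where
  "add_prog =
     Seq (Store 5 count_expr agent_expr)
    (Seq (Store 6 count_expr object_expr)
    (Seq (Store 8 agent_expr (Const 1))
    (Seq (Store 9 object_expr (Const 1))
         (Store 4 (Const 0) (Plus count_expr (Const 1))))))"

text \<open>The sum acts as a disjunction: a pair is skipped if \<open>g\<close> is nonzero or its
  agent or object is flagged.\<close>

definition step_prog :: "expr \<Rightarrow> prog" where
  "step_prog g =
     Seq (Cond (Plus g (Plus (Load 8 agent_expr) (Load 9 object_expr))) Skip add_prog)
         (Store 7 (Const 0) (Plus (Load 7 (Const 0)) (Const 1)))"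

text \<open>Truncated subtraction is nonzero exactly while the position is below the list
  length.\<close>

definition loop_prog :: "expr \<Rightarrow> prog" where
  "loop_prog g = While (Minus (Load 0 (Const 2)) (Load 7 (Const 0))) (step_prog g)"

text \<open>Only the position is reset between the scans; flags and output persist, so the second
  scan extends the result of the first.\<close>

definition greedy_prog :: prog where
  "greedy_prog =
     Seq (loop_prog (Load 3 (Load 7 (Const 0))))
    (Seq (Store 7 (Const 0) (Const 0)) (loop_prog (Const 0)))"

text \<open>The invariant of both scans, with \<open>M\<close> the matching built so far and
  \<open>j\<close> the next position.\<close>

definition represents ::
    "(nat \<times> nat \<Rightarrow> nat) \<Rightarrow> (nat \<times> nat) list \<Rightarrow> mem \<Rightarrow> (nat \<times> nat) set \<Rightarrow> nat \<Rightarrow> bool" where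
  "represents r es s M j \<longleftrightarrow>
     s 0 2 = length es \<and>
     (\<forall>k<length es. s 1 k = fst (es ! k) \<and> s 2 k = snd (es ! k) \<and> s 3 k = r (es ! k)) \<and>
     s 7 0 = j \<and> output_matching s = M \<and>
     (\<forall>a. s 8 a = 0 \<longleftrightarrow> a \<notin> Domain M) \<and> (\<forall>b. s 9 b = 0 \<longleftrightarrow> b \<notin> Range M)"

definition add_pair :: "mem \<Rightarrow> nat \<Rightarrow> nat \<Rightarrow> mem" where
  "add_pair s a b = s(4 := (s 4)(0 := s 4 0 + 1), 5 := (s 5)(s 4 0 := a), 6 := (s 6)(s 4 0 := b),
     8 := (s 8)(a := 1), 9 := (s 9)(b := 1))"

lemma run_add_prog:
  assumes "s 1 (s 7 0) = a" "s 2 (s 7 0) = b"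
  obtains t where "run add_prog s t (add_pair s a b)" "t \<le> 40"
proof -
  have "\<exists>t s'. run add_prog s t s' \<and> t \<le> 40 \<and> s' = add_pair s a b"
    unfolding add_prog_def
    \<comment> \<open>The witnesses stay schematic, and the rules of \<open>run\<close> compute
      them. The exact cost is 28 steps; 40 is a rounded bound.\<close>
    apply (intro exI conjI)
      apply (rule run_Seq run_Store)+
    using assms
     apply (simp_all add: agent_expr_def object_expr_def count_expr_def add_pair_def fun_upd_twist)
    done
  then show thesis using that by blast
qed

text \<open>The new pair is written at index \<open>s 4 0\<close>, just past the old entries, which
  therefore survive.\<close>

lemma output_matching_add_pair:
  "output_matching (add_pair s a b) = insert (a, b) (output_matching s)"
proof -
  have "output_matching (add_pair s a b) =
      (\<lambda>j. (add_pair s a b 5 j, add_pair s a b 6 j)) ` {..<Suc (s 4 0)}"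
    by (auto simp: output_matching_def add_pair_def)
  also have "\<dots> = insert (a, b) ((\<lambda>j. (s 5 j, s 6 j)) ` {..<s 4 0})"
    unfolding lessThan_Suc image_insert
    by (intro arg_cong2[of _ _ _ _ insert] image_cong) (auto simp: add_pair_def)
  also have "(\<lambda>j. (s 5 j, s 6 j)) ` {..<s 4 0} = output_matching s"
    by (auto simp: output_matching_def)
  finally show ?thesis .
qed

text \<open>With \<open>j'\<close> arbitrary this serves both for passing over a pair and for the
  reset between the scans.\<close>

lemma represents_skip:
  assumes "represents r es s M j"
  shows "represents r es (s(7 := (s 7)(0 := j'))) M j'"
  using assms by (simp add: represents_def output_matching_def)

lemma represents_add:
  assumes "represents r es s M j"
  shows "represents r es ((add_pair s a b)(7 := (s 7)(0 := j'))) (insert (a, b) M) j'"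
proof -
  have "output_matching ((add_pair s a b)(7 := (s 7)(0 := j'))) = output_matching (add_pair s a b)"
    by (simp add: output_matching_def)
  then show ?thesis
    using assms output_matching_add_pair[of s a b]
    by (auto simp: represents_def add_pair_def)
qed

lemma run_step_prog:
  assumes rep: "represents r es s M j" and j: "j < length es" and g: "expr_cost g \<le> 4"
  shows "\<exists>t s'. run (step_prog g) s t s' \<and> t \<le> 70 \<and>
    represents r es s' (if eval_expr g s = 0 then greedy_step (es ! j) M else M) (Suc j)"
proof -
  obtain a b where e: "es ! j = (a, b)" by force
  have ab: "s 1 (s 7 0) = a" "s 2 (s 7 0) = b" and s7: "s 7 0 = j"
    and taken: "s 8 a = 0 \<longleftrightarrow> a \<notin> Domain M" "s 9 b = 0 \<longleftrightarrow> b \<notin> Range M"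
    using rep j e unfolding represents_def by auto
  let ?c = "Plus g (Plus (Load 8 agent_expr) (Load 9 object_expr))"
  let ?incr = "Store 7 (Const 0) (Plus (Load 7 (Const 0)) (Const 1))"
  have c: "eval_expr ?c s = 0 \<longleftrightarrow> eval_expr g s = 0 \<and> a \<notin> Domain M \<and> b \<notin> Range M"
    using ab taken by (simp add: agent_expr_def object_expr_def)
  \<comment> \<open>The longest path takes at most 1 + 14 + 40 + 6 = 61 steps.\<close>
  have cost: "expr_cost ?c \<le> 14"
    using g by (simp add: agent_expr_def object_expr_def)
  have incr: "run ?incr s' 6 (s'(7 := (s' 7)(0 := Suc j)))" if "s' 7 = s 7" for s'
    using run_Store[of 7 "Const 0" "Plus (Load 7 (Const 0)) (Const 1)" s'] that s7
    by (simp add: eval_nat_numeral)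
  show ?thesis
  proof (cases "eval_expr ?c s = 0")
    case True
    obtain t where t: "run add_prog s t (add_pair s a b)" "t \<le> 40"
      using run_add_prog ab by blast
    have s7': "add_pair s a b 7 = s 7" by (simp add: add_pair_def)
    have "run (step_prog g) s (1 + expr_cost ?c + t + 6)
        ((add_pair s a b)(7 := (add_pair s a b 7)(0 := Suc j)))"
      unfolding step_prog_def
      by (rule run_Seq[OF run_Cond_False[OF True t(1)] incr[of "add_pair s a b", OF s7']])
    moreover have "greedy_step (es ! j) M = insert (a, b) M"
      using True c e by (simp add: greedy_step_def)
    ultimately show ?thesis
      using represents_add[OF rep, of a b "Suc j"] True c t(2) cost s7'
      by (intro exI conjI) auto
  next
    case False
    have "run (step_prog g) s (1 + expr_cost ?c + 1 + 6) (s(7 := (s 7)(0 := Suc j)))"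
      unfolding step_prog_def
      by (rule run_Seq[OF run_Cond_True[OF False run_Skip] incr[of s, OF refl]])
    moreover have "(if eval_expr g s = 0 then greedy_step (es ! j) M else M) = M"
      using False c e by (auto simp: greedy_step_def)
    ultimately show ?thesis
      using represents_skip[OF rep, of "Suc j"] cost
      by (intro exI conjI) auto
  qed
qed

text \<open>Induction on the number of remaining pairs. The guard is tied to a predicate
  \<open>Q\<close> on pairs, so a scan becomes a fold over a filtered list. An iteration costs at
  most 6 + 70 steps, the final failing test 6.\<close>

lemma run_loop_prog:
  assumes "represents r es s M j" "j \<le> length es" "expr_cost g \<le> 4"
    and g: "\<And>s M j. represents r es s M j \<Longrightarrow> j < length es \<Longrightarrow> eval_expr g s = 0 \<longleftrightarrow> Q (es ! j)"
  shows "\<exists>t s'. run (loop_prog g) s t s' \<and> t \<le> 80 * (length es - j) + 10 \<and>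
    represents r es s' (fold greedy_step (filter Q (drop j es)) M) (length es)"
  using assms(1,2)
proof (induction "length es - j" arbitrary: s M j)
  case 0
  let ?c = "Minus (Load 0 (Const 2)) (Load 7 (Const 0))"
  have "j = length es" using 0 by simp
  then have "eval_expr ?c s = 0" using 0 by (simp add: represents_def)
  then have "run (loop_prog g) s (1 + expr_cost ?c) s"
    unfolding loop_prog_def by (rule run_While_False)
  then show ?case
    using 0 \<open>j = length es\<close> by (intro exI conjI) auto
next
  case (Suc d)
  let ?c = "Minus (Load 0 (Const 2)) (Load 7 (Const 0))"
  let ?M = "if Q (es ! j) then greedy_step (es ! j) M else M"
  have j: "j < length es" using Suc.hyps(2) by simp
  then have c: "eval_expr ?c s \<noteq> 0" using Suc.prems by (simp add: represents_def)
  obtain t s1 where 1: "run (step_prog g) s t s1" "t \<le> 70" "represents r es s1 ?M (Suc j)"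
    using run_step_prog[OF Suc.prems(1) j assms(3)] g[OF Suc.prems(1) j] by auto
  obtain u s2 where 2: "run (loop_prog g) s1 u s2" "u \<le> 80 * (length es - Suc j) + 10"
      "represents r es s2 (fold greedy_step (filter Q (drop (Suc j) es)) ?M) (length es)"
    using Suc.hyps(1)[OF _ 1(3)] Suc.hyps(2) j by fastforce
  have "run (loop_prog g) s (1 + expr_cost ?c + t + u) s2"
    using run_While_True[OF c 1(1)] 2(1) unfolding loop_prog_def by blast
  moreover have "1 + expr_cost ?c + t + u \<le> 80 * (length es - j) + 10"
    using 1(2) 2(2) j by simp
  moreover have "drop j es = es ! j # drop (Suc j) es" using j by (simp add: Cons_nth_drop_Suc)
  then have "fold greedy_step (filter Q (drop (Suc j) es)) ?M
      = fold greedy_step (filter Q (drop j es)) M" by simp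
  ultimately show ?case using 2(3) by metis
qed

lemma run_greedy_prog:
  assumes "represents r es s {} 0"
  shows "\<exists>t s'. run greedy_prog s t s' \<and> t \<le> 160 * length es + 30 \<and>
    output_matching s' = two_phase r es"
proof -
  let ?G = "fold greedy_step (filter (\<lambda>e. r e = 0) es) {}"
  obtain t1 s1 where 1: "run (loop_prog (Load 3 (Load 7 (Const 0)))) s t1 s1"
      "t1 \<le> 80 * length es + 10" "represents r es s1 ?G (length es)"
    using run_loop_prog[OF assms, of "Load 3 (Load 7 (Const 0))" "\<lambda>e. r e = 0"]
    by (auto simp: represents_def)
  let ?s = "s1(7 := (s1 7)(0 := 0))"
  have 2: "run (Store 7 (Const 0) (Const 0)) s1 3 ?s"
    using run_Store[of 7 "Const 0" "Const 0" s1] by (simp add: eval_nat_numeral)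
  have "represents r es ?s ?G 0" using 1(3) by (rule represents_skip)
  from run_loop_prog[OF this, of "Const 0" "\<lambda>e. True"]
  obtain t2 s2 where 3: "run (loop_prog (Const 0)) ?s t2 s2"
      "t2 \<le> 80 * length es + 10" "represents r es s2 (fold greedy_step es ?G) (length es)"
    by auto
  have "run greedy_prog s (t1 + (3 + t2)) s2"
    unfolding greedy_prog_def using 1 2 3 by (blast intro: run_Seq)
  moreover have "output_matching s2 = two_phase r es"
    using 3(3) by (simp add: represents_def two_phase_def)
  ultimately show ?thesis using 1(2) 3(2) by (intro exI conjI) auto
qed

section \<open>Initial memory and the time bound\<close>

lemma represents_input_mem:
  "represents (\<lambda>(i, x). tie_index H i x) es (input_mem H es) {} 0"
  by (auto simp: represents_def input_mem_def output_matching_def split: prod.splits)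

text \<open>Linear time is within the bound: a listed pair has an agent, so the square root is at
  least 1, and without pairs both sides are 0.\<close>

lemma length_le_sqrt_n_m:
  assumes "house_allocation H" "lists_pairs es H"
  shows "real (length es) \<le> sqrt_n_m H"
proof (cases "es = []")
  case True
  then show ?thesis by (simp add: sqrt_n_m_def)
next
  case False
  have len: "length es = card (acceptable_pairs H)"
    using assms(2) by (metis distinct_card lists_pairs_def)
  have "Agents H \<noteq> {}"
    using False assms(2) by (auto simp: lists_pairs_def acceptable_pairs_def)
  then have "card (Agents H) \<ge> 1"
    using assms(1) by (simp add: house_allocation_def Suc_le_eq card_gt_0_iff)
  then have "1 * real (card (acceptable_pairs H)) \<le> sqrt_n_m H"
    unfolding sqrt_n_m_def by (intro mult_right_mono) auto
  then show ?thesis by (simp add: len)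
qed

lemma two_phase_greedy_found_in_time:
  assumes "\<And>H M. house_allocation H \<Longrightarrow> \<C> H \<Longrightarrow> two_phase_greedy H M \<Longrightarrow> Sol H M"
  shows "found_in_time \<C> Sol sqrt_n_m"
  unfolding found_in_time_def
\<comment> \<open>The constant is 160 + 30; the maximum with 1 absorbs the additive 30.\<close>
proof (intro exI[of _ greedy_prog] exI[of _ "190 :: real"] allI impI)
  fix H :: "(nat, nat) house_model" and es
  assume *: "house_allocation H \<and> numbered H \<and> \<C> H \<and> lists_pairs es H"
  let ?M = "two_phase (\<lambda>(i, x). tie_index H i x) es"
  obtain t s' where run: "run greedy_prog (input_mem H es) t s'" "t \<le> 160 * length es + 30"
      "output_matching s' = ?M"
    using run_greedy_prog[OF represents_input_mem] by blast
  have "two_phase_greedy H ?M"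
    using * by (intro two_phase_greedy_two_phase) (simp add: lists_pairs_def)
  then have "Sol H (output_matching s')" using assms * run(3) by simp
  moreover have "real t \<le> 190 * max 1 (sqrt_n_m H)"
  proof -
    have "real t \<le> 160 * real (length es) + 30" using run(2) by linarith
    also have "\<dots> \<le> 160 * max 1 (sqrt_n_m H) + 30 * max 1 (sqrt_n_m H)"
      using length_le_sqrt_n_m[of H es] * by (intro add_mono) auto
    finally show ?thesis by simp
  qed
  ultimately show "\<exists>t s'. run greedy_prog (input_mem H es) t s' \<and>
      real t \<le> 190 * max 1 (sqrt_n_m H) \<and> Sol H (output_matching s')"
    using run(1) by blast
qed

theorem theorem6:
  "((\<forall>H :: ('a, 'b) house_model. house_allocation H \<and> single_tie H \<longrightarrow>
        (\<exists>M. majority_stable H M)) \<and>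
    found_in_time single_tie majority_stable sqrt_n_m) \<and>
   ((\<forall>H :: ('a, 'b) house_model. house_allocation H \<and> dichotomous_complete H \<and>
          card (Objects H) \<ge> card (Agents H) \<longrightarrow>
        (\<exists>M. majority_stable H M)) \<and>
    found_in_time (\<lambda>H. dichotomous_complete H \<and> card (Objects H) \<ge> card (Agents H))
      majority_stable sqrt_n_m) \<and>
   ((\<forall>H :: ('a, 'b) house_model. house_allocation H \<and> dichotomous_complete H \<and>
          card (Objects H) < card (Agents H) \<longrightarrow>
        (\<exists>M. k_stable (2 * real (card (Agents H)) / 3 + 1) H M)) \<and>
    found_in_time (\<lambda>H. dichotomous_complete H \<and> card (Objects H) < card (Agents H))
      (\<lambda>H. k_stable (2 * real (card (Agents H)) / 3 + 1) H) sqrt_n_m)"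
proof (intro conjI allI impI; (elim conjE)?)
  fix H :: "('a, 'b) house_model"
  assume H: "house_allocation H"
  \<comment> \<open>One matching serves all three existence claims. It comes from the abstract fold,
    as the types are arbitrary here and the program handles only numbered instances.\<close>
  obtain M where M: "two_phase_greedy H M" using two_phase_greedy_exists[OF H] by blast
  show "\<exists>M. majority_stable H M" if "single_tie H"
    using single_tie_majority_stable[OF H that M] by blast
  show "\<exists>M. majority_stable H M"
    if "dichotomous_complete H" "card (Objects H) \<ge> card (Agents H)"
    using dichotomous_majority_stable[OF H that M] by blast
  show "\<exists>M. k_stable (2 * real (card (Agents H)) / 3 + 1) H M"
    if "dichotomous_complete H" "card (Objects H) < card (Agents H)"
    using dichotomous_two_thirds_stable[OF H that M] by blast
next
  show "found_in_time single_tie majority_stable sqrt_n_m"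
    by (intro two_phase_greedy_found_in_time single_tie_majority_stable)
  show "found_in_time (\<lambda>H. dichotomous_complete H \<and> card (Objects H) \<ge> card (Agents H))
      majority_stable sqrt_n_m"
    by (intro two_phase_greedy_found_in_time dichotomous_majority_stable) auto
  show "found_in_time (\<lambda>H. dichotomous_complete H \<and> card (Objects H) < card (Agents H))
      (\<lambda>H. k_stable (2 * real (card (Agents H)) / 3 + 1) H) sqrt_n_m"
    by (intro two_phase_greedy_found_in_time dichotomous_two_thirds_stable) auto
qed

end
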